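(* Let $0<p<\infty$, let $\sigma_1,\sigma_2$ be weight functions on $T$, let $\varphi:T\to T$ be a self map and $\psi:T\to\mathbb{C}$ a function, and suppose that $W_{\psi,\varphi}(f)=\psi\,(f\circ\varphi)$ maps $\mathbb{T}_{\sigma_1,p}$ into $\mathbb{T}_{\sigma_2,p}$. Consider the operator $W_{\psi,\varphi}:\mathbb{T}_{\sigma_1,p}\to\mathbb{T}_{\sigma_2,p}$. (i) The operator $W_{\psi,\varphi}$ is compact if $$\sup_{n\in\mathbb{N}_0}\frac{1}{c_n}\sum_{|x|=n,\ |\varphi(x)|\ge m}\left|\frac{\sigma_2(x)\psi(x)}{\sigma_1(\varphi(x))}\right|^p c_{|\varphi(x)|}\to0\quad\text{as } m\to\infty.$$ (ii) If $W_{\psi,\varphi}$ is a compact operator, then $$\sup_{n\in\mathbb{N}_0}\frac{1}{c_n}\sum_{|x|=n,\ |\varphi(x)|\ge m}\left|\frac{\sigma_2(x)\psi(x)}{\sigma_1(\varphi(x))}\right|^p\to0\quad\text{as } m\to\infty.$$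
   Context: $T$ is an infinite rooted tree, identified with its vertex set; $|x|$ is the edge-counting distance from the root $o$ to the vertex $x$; $c_n$ is the number of vertices $x$ with $|x|=n$, $n\in\mathbb{N}_0=\{0,1,2,\dots\}$. Standing assumptions: every $c_n$ is finite and the sequence $\{c_n\}$ is unbounded. A weight function is a function $\sigma:T\to(0,\infty)$. For a weight $\sigma$, $0<p<\infty$ and $f:T\to\mathbb{C}$, put $M_{\sigma,p}(n,f)=\left(\frac{1}{c_n}\sum_{|x|=n}\sigma(x)^p|f(x)|^p\right)^{1/p}$ and $\|f\|_{\sigma,p}=\sup_{n\in\mathbb{N}_0}M_{\sigma,p}(n,f)$. The space $\mathbb{T}_{\sigma,p}$ is the set of all $f:T\to\mathbb{C}$ with $\|f\|_{\sigma,p}<\infty$. A linear operator $A:X\to Y$ between such spaces is compact if for every bounded sequence $(f_n)$ in $X$ the sequence $(Af_n)$ has a subsequence converging in $Y$ with respect to $\|\cdot\|_Y$. Sums over the empty set are $0$. *)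

theory Defs
  imports "HOL-Analysis.Analysis"
begin

text \<open>
  The vertex set of the tree is the type \<open>'v\<close>; the edges are given by an adjacency relation.
  A cycle is recorded without repeating its initial vertex; the length bound excludes
  traversing a single edge back and forth.
\<close>

definition is_cycle :: "('v \<Rightarrow> 'v \<Rightarrow> bool) \<Rightarrow> 'v list \<Rightarrow> bool" where
  "is_cycle adj xs \<longleftrightarrow>
     length xs \<ge> 3 \<and> distinct xs \<and> successively adj xs \<and> adj (last xs) (hd xs)"

definition is_tree :: "('v \<Rightarrow> 'v \<Rightarrow> bool) \<Rightarrow> bool" where
  "is_tree adj \<longleftrightarrow>
     symp adj \<and> irreflp adj \<and> (\<forall>x y. adj\<^sup>*\<^sup>* x y) \<and> (\<nexists>xs. is_cycle adj xs)"

text \<open>The number of edges of a shortest walk between two vertices (for connected \<open>adj\<close>).\<close>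

definition graph_dist :: "('v \<Rightarrow> 'v \<Rightarrow> bool) \<Rightarrow> 'v \<Rightarrow> 'v \<Rightarrow> nat" where
  "graph_dist adj x y = (LEAST n. (adj ^^ n) x y)"

definition sphere_at :: "('v \<Rightarrow> 'v \<Rightarrow> bool) \<Rightarrow> 'v \<Rightarrow> nat \<Rightarrow> 'v set" where
  "sphere_at adj rt n = {x. graph_dist adj rt x = n}"

definition level_count :: "('v \<Rightarrow> 'v \<Rightarrow> bool) \<Rightarrow> 'v \<Rightarrow> nat \<Rightarrow> nat" where
  "level_count adj rt n = card (sphere_at adj rt n)"

definition weight_function :: "('v \<Rightarrow> real) \<Rightarrow> bool" where
  "weight_function \<sigma> \<longleftrightarrow> (\<forall>x. 0 < \<sigma> x)"

definition level_mean ::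
  "('v \<Rightarrow> 'v \<Rightarrow> bool) \<Rightarrow> 'v \<Rightarrow> ('v \<Rightarrow> real) \<Rightarrow> real \<Rightarrow> nat \<Rightarrow> ('v \<Rightarrow> complex) \<Rightarrow> real" where
  "level_mean adj rt \<sigma> p n f =
     ((1 / real (level_count adj rt n)) *
        (\<Sum>x\<in>sphere_at adj rt n. \<sigma> x powr p * cmod (f x) powr p)) powr (1 / p)"

text \<open>
  The supremum is taken in \<open>[0,\<infinity>]\<close>, so that it is meaningful for every function.
\<close>

definition tnorm ::
  "('v \<Rightarrow> 'v \<Rightarrow> bool) \<Rightarrow> 'v \<Rightarrow> ('v \<Rightarrow> real) \<Rightarrow> real \<Rightarrow> ('v \<Rightarrow> complex) \<Rightarrow> ennreal" where
  "tnorm adj rt \<sigma> p f = (SUP n. ennreal (level_mean adj rt \<sigma> p n f))"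

definition tspace ::
  "('v \<Rightarrow> 'v \<Rightarrow> bool) \<Rightarrow> 'v \<Rightarrow> ('v \<Rightarrow> real) \<Rightarrow> real \<Rightarrow> ('v \<Rightarrow> complex) set" where
  "tspace adj rt \<sigma> p = {f. tnorm adj rt \<sigma> p f < \<infinity>}"

definition weighted_comp ::
  "('v \<Rightarrow> complex) \<Rightarrow> ('v \<Rightarrow> 'v) \<Rightarrow> ('v \<Rightarrow> complex) \<Rightarrow> ('v \<Rightarrow> complex)" where
  "weighted_comp \<psi> \<phi> f = (\<lambda>x. \<psi> x * f (\<phi> x))"

definition linear_operator ::
  "('v \<Rightarrow> complex) set \<Rightarrow> ('w \<Rightarrow> complex) set \<Rightarrow> (('v \<Rightarrow> complex) \<Rightarrow> ('w \<Rightarrow> complex)) \<Rightarrow> bool" where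
  "linear_operator X Y A \<longleftrightarrow>
     A ` X \<subseteq> Y \<and>
     (\<forall>f\<in>X. \<forall>g\<in>X. \<forall>a b. A (\<lambda>x. a * f x + b * g x) = (\<lambda>x. a * A f x + b * A g x))"

definition compact_operator ::
  "('v \<Rightarrow> complex) set \<Rightarrow> (('v \<Rightarrow> complex) \<Rightarrow> ennreal) \<Rightarrow>
   ('w \<Rightarrow> complex) set \<Rightarrow> (('w \<Rightarrow> complex) \<Rightarrow> ennreal) \<Rightarrow>
   (('v \<Rightarrow> complex) \<Rightarrow> ('w \<Rightarrow> complex)) \<Rightarrow> bool" where
  "compact_operator X NX Y NY A \<longleftrightarrow>
     linear_operator X Y A \<and>
     (\<forall>f :: nat \<Rightarrow> 'v \<Rightarrow> complex.
        (\<forall>k. f k \<in> X) \<and> (\<exists>C :: real. \<forall>k. NX (f k) \<le> ennreal C) \<longrightarrow>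
        (\<exists>s :: nat \<Rightarrow> nat. strict_mono s \<and>
          (\<exists>g\<in>Y. (\<lambda>k. NY (\<lambda>x. A (f (s k)) x - g x)) \<longlonglongrightarrow> 0)))"

end

theory Submission
  imports Defs "HOL-Complex_Analysis.Great_Picard"
begin

text \<open>
  Write \<open>w x = \<bar>\<sigma>\<^sub>2 x * \<psi> x / \<sigma>\<^sub>1 (\<phi> x)\<bar>\<close>. Then \<open>\<sigma>\<^sub>2 \<bar>W f\<bar>\<close> at \<open>x\<close> equals
  \<open>w x\<close> times \<open>\<sigma>\<^sub>1 \<bar>f\<bar>\<close> at \<open>\<phi> x\<close>, and the bound \<open>(\<sigma>\<^sub>1 \<bar>f\<bar>)\<^sup>p \<le> c \<parallel>f\<parallel>\<^sup>p\<close> holds on a level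
  with \<open>c\<close> vertices.

  For (i), a bounded sequence has a pointwise convergent subsequence. The contribution to
  the norm of the vertices with \<open>\<bar>\<phi> x\<bar> \<ge> m\<close> is small by the hypothesis and the pointwise bound.
  On the finite set of vertices of level below \<open>m\<close> the convergence is uniform, and
  the averages of \<open>w\<^sup>p\<close> over \<open>\<bar>\<phi> x\<bar> < m\<close> are bounded, because \<open>W\<close> maps the function that
  equals \<open>1 / \<sigma>\<^sub>1\<close> on that finite set and \<open>0\<close> elsewhere into the target space.

  For (ii), the functions \<open>g\<^sub>m\<close> equal to \<open>1 / \<sigma>\<^sub>1\<close> on the levels \<open>\<ge> m\<close> and to \<open>0\<close> elsewhere have
  norm at most \<open>1\<close>, and \<open>\<parallel>W g\<^sub>m\<parallel>\<^sup>p\<close> is the \<open>m\<close>-th supremum. Since \<open>W g\<^sub>m\<close> tends to \<open>0\<close> pointwise,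
  compactness forces \<open>\<parallel>W g\<^sub>m\<parallel>\<close> to tend to \<open>0\<close> along a subsequence, and the suprema decrease in \<open>m\<close>.
\<close>

section \<open>Null sequences in [0, infinity] and pointwise convergent subsequences\<close>

lemma ennreal_LIMSEQ_0_iff:
  fixes X :: "nat \<Rightarrow> ennreal"
  shows "X \<longlonglongrightarrow> 0 \<longleftrightarrow> (\<forall>e>0. \<exists>N. \<forall>k\<ge>N. X k \<le> ennreal e)"
proof
  assume X: "X \<longlonglongrightarrow> 0"
  show "\<forall>e>0. \<exists>N. \<forall>k\<ge>N. X k \<le> ennreal e"
  proof (intro allI impI)
    fix e :: real assume "0 < e"
    then have "\<forall>\<^sub>F k in sequentially. X k < ennreal e"
      using order_tendstoD(2)[OF X] by simp
    then show "\<exists>N. \<forall>k\<ge>N. X k \<le> ennreal e"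
      by (auto simp: eventually_sequentially intro: less_imp_le)
  qed
next
  assume R: "\<forall>e>0. \<exists>N. \<forall>k\<ge>N. X k \<le> ennreal e"
  show "X \<longlonglongrightarrow> 0"
  proof (rule order_tendstoI)
    fix a :: ennreal assume "0 < a"
    \<comment> \<open>The intermediate \<open>b\<close> is finite even when \<open>a\<close> is
      infinite, and it turns the non-strict bound into a strict one.\<close>
    then obtain b where b: "0 < b" "b < a" using dense by blast
    then obtain e where e: "b = ennreal e" "0 < e"
      by (cases b) (auto simp: top_unique)
    with R obtain N where "\<And>k. k \<ge> N \<Longrightarrow> X k \<le> b" by blast
    then show "\<forall>\<^sub>F k in sequentially. X k < a"
      using b(2) unfolding eventually_sequentially by (meson le_less_trans)
  qed simp
qed

text \<open>\<open>function_convergent_subsequence\<close> takes one bound for all points. Dividing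
  by \<open>D x\<close>, where the summand 1 keeps \<open>D x\<close> nonzero, reduces to the bound
  1; the limits are then multiplied back.\<close>

lemma pointwise_convergent_subsequence:
  fixes f :: "nat \<Rightarrow> 'a \<Rightarrow> complex" and M :: "'a \<Rightarrow> real"
  assumes "countable (UNIV :: 'a set)" and f: "\<And>k x. cmod (f k x) \<le> M x"
  obtains s g where "strict_mono (s :: nat \<Rightarrow> nat)" "\<And>x. (\<lambda>k. f (s k) x) \<longlonglongrightarrow> g x"
proof -
  define D where "D x = complex_of_real (M x + 1)" for x
  have M: "0 \<le> M x" for x using f[of 0 x] norm_ge_zero order_trans by blast
  have D: "D x \<noteq> 0" "cmod (D x) = M x + 1" for x
    using M[of x] by (auto simp: D_def complex_eq_iff simp del: of_real_add)
  have "cmod (f k x / D x) \<le> 1" for k x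
    using f[of k x] M[of x] by (simp add: norm_divide D)
  then obtain s where s: "strict_mono (s :: nat \<Rightarrow> nat)"
    "\<And>x. x \<in> UNIV \<Longrightarrow> \<exists>l. (\<lambda>k. f (s k) x / D x) \<longlonglongrightarrow> l"
    by (rule function_convergent_subsequence[OF assms(1), of "\<lambda>k x. f k x / D x" 1]) auto
  then obtain l where l: "\<And>x. (\<lambda>k. f (s k) x / D x) \<longlonglongrightarrow> l x" by (metis UNIV_I)
  have "(\<lambda>k. f (s k) x) \<longlonglongrightarrow> l x * D x" for x
    using tendsto_mult[OF l[of x] tendsto_const[of "D x"]] D(1)[of x] by simp
  with s(1) show thesis by (rule that)
qed

section \<open>Averages over finite levels\<close>

locale graded_graph =
  fixes adj :: "'v \<Rightarrow> 'v \<Rightarrow> bool" and rt :: 'v and p :: real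
  assumes finite_sphere: "finite (sphere_at adj rt n)"
    and p_pos: "0 < p"
begin

abbreviation lev :: "'v \<Rightarrow> nat" where "lev \<equiv> graph_dist adj rt"
abbreviation S :: "nat \<Rightarrow> 'v set" where "S \<equiv> sphere_at adj rt"
abbreviation c :: "nat \<Rightarrow> nat" where "c \<equiv> level_count adj rt"

text \<open>The p-th power of \<open>level_mean\<close>: without the root, sums over a level can be
  split and compared term by term.\<close>

definition mean_pow :: "('v \<Rightarrow> real) \<Rightarrow> nat \<Rightarrow> ('v \<Rightarrow> complex) \<Rightarrow> real" where
  "mean_pow \<sigma> n f = (1 / real (c n)) * (\<Sum>x\<in>S n. \<sigma> x powr p * cmod (f x) powr p)"

lemma in_sphere_iff: "x \<in> S n \<longleftrightarrow> lev x = n"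
  by (simp add: sphere_at_def)

lemma level_count_pos: "0 < c (lev x)"
  unfolding level_count_def using finite_sphere card_gt_0_iff in_sphere_iff by blast

lemma finite_levels_less: "finite {y. lev y < m}"
proof -
  have "{y. lev y < m} = (\<Union>n<m. S n)" by (auto simp: in_sphere_iff)
  then show ?thesis using finite_sphere by simp
qed

lemma countable_vertices: "countable (UNIV :: 'v set)"
proof -
  have "UNIV = (\<Union>n. S n)" by (auto simp: in_sphere_iff)
  then show ?thesis using finite_sphere countable_finite by (metis countable_UN countableI_type)
qed

lemma mean_pow_nonneg: "0 \<le> mean_pow \<sigma> n f"
  by (auto simp: mean_pow_def intro!: divide_nonneg_nonneg sum_nonneg)

text \<open>Taking p-th roots preserves and reflects order on nonnegative reals, so norm estimates
  become bounds on averages uniform in the level.\<close>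

lemma tnorm_le_iff:
  assumes "0 \<le> C"
  shows "tnorm adj rt \<sigma> p f \<le> ennreal C \<longleftrightarrow> (\<forall>n. mean_pow \<sigma> n f \<le> C powr p)"
proof -
  have "mean_pow \<sigma> n f powr (1 / p) \<le> C \<longleftrightarrow> mean_pow \<sigma> n f \<le> C powr p" for n
  proof -
    have "mean_pow \<sigma> n f powr (1 / p) \<le> (C powr p) powr (1 / p) \<longleftrightarrow> mean_pow \<sigma> n f \<le> C powr p"
      using mean_pow_nonneg[of \<sigma> n f] p_pos
        powr_mono2[of "1 / p" "mean_pow \<sigma> n f" "C powr p"]
        powr_less_mono2[of "1 / p" "C powr p" "mean_pow \<sigma> n f"] by force
    then show ?thesis using assms p_pos by (simp add: powr_powr)
  qed
  then show ?thesis using assms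
    unfolding tnorm_def level_mean_def mean_pow_def[symmetric] by (simp add: SUP_le_iff ennreal_le_iff)
qed

lemma tspace_iff: "f \<in> tspace adj rt \<sigma> p \<longleftrightarrow> (\<exists>C\<ge>0. \<forall>n. mean_pow \<sigma> n f \<le> C powr p)"
proof -
  have "tnorm adj rt \<sigma> p f < \<infinity> \<longleftrightarrow> (\<exists>C\<ge>0. tnorm adj rt \<sigma> p f \<le> ennreal C)"
    by (cases "tnorm adj rt \<sigma> p f") (auto simp: top_unique)
  then show ?thesis by (auto simp: tspace_def tnorm_le_iff)
qed

text \<open>One summand is at most the whole sum. The level size appearing here is the source of the
  extra factor in condition (i).\<close>

lemma weight_pow_le_mean_pow:
  "\<sigma> y powr p * cmod (f y) powr p \<le> real (c (lev y)) * mean_pow \<sigma> (lev y) f"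
proof -
  have "\<sigma> y powr p * cmod (f y) powr p \<le> (\<Sum>x\<in>S (lev y). \<sigma> x powr p * cmod (f x) powr p)"
    by (rule member_le_sum) (auto simp: in_sphere_iff finite_sphere)
  then show ?thesis using level_count_pos[of y] by (simp add: mean_pow_def)
qed

text \<open>Each summand is 0 or 1. The predicate is left free because cutoffs below a level and
  from a level on are both used.\<close>

lemma mean_pow_cutoff:
  assumes "weight_function \<sigma>"
  shows "mean_pow \<sigma> n (\<lambda>y. if P y then 1 / complex_of_real (\<sigma> y) else 0) \<le> 1"
proof -
  have "(\<Sum>x\<in>S n. \<sigma> x powr p * cmod (if P x then 1 / complex_of_real (\<sigma> x) else 0) powr p)
      \<le> (\<Sum>x\<in>S n. 1)"
  proof (rule sum_mono)
    fix x
    have "0 < \<sigma> x" using assms by (simp add: weight_function_def)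
    then show "\<sigma> x powr p * cmod (if P x then 1 / complex_of_real (\<sigma> x) else 0) powr p \<le> 1"
      by (simp add: norm_divide powr_divide)
  qed
  \<comment> \<open>On an empty level the average is 0, since 1 / 0 = 0.\<close>
  then show ?thesis
    by (cases "c n = 0") (auto simp: mean_pow_def level_count_def field_simps)
qed

lemma tnorm_cutoff:
  assumes "weight_function \<sigma>"
  shows "tnorm adj rt \<sigma> p (\<lambda>y. if P y then 1 / complex_of_real (\<sigma> y) else 0) \<le> ennreal 1"
  using mean_pow_cutoff[OF assms] by (subst tnorm_le_iff) auto

lemma cutoff_in_tspace:
  assumes "weight_function \<sigma>"
  shows "(\<lambda>y. if P y then 1 / complex_of_real (\<sigma> y) else 0) \<in> tspace adj rt \<sigma> p"
  using tnorm_cutoff[OF assms, of P] by (auto simp: tspace_def intro: le_less_trans)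

end

section \<open>Averages of images under the weighted composition operator\<close>

locale weighted_comp_map = graded_graph adj rt p
  for adj :: "'v \<Rightarrow> 'v \<Rightarrow> bool" and rt :: 'v and p :: real +
  fixes \<sigma>1 \<sigma>2 :: "'v \<Rightarrow> real" and \<phi> :: "'v \<Rightarrow> 'v" and \<psi> :: "'v \<Rightarrow> complex"
  assumes \<sigma>1: "weight_function \<sigma>1" and \<sigma>2: "weight_function \<sigma>2"
    and maps_into: "f \<in> tspace adj rt \<sigma>1 p \<Longrightarrow> weighted_comp \<psi> \<phi> f \<in> tspace adj rt \<sigma>2 p"
begin

definition w :: "'v \<Rightarrow> real" where
  "w x = cmod (complex_of_real (\<sigma>2 x) * \<psi> x / complex_of_real (\<sigma>1 (\<phi> x)))"

lemma weighted_comp_pow: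
  "\<sigma>2 x powr p * cmod (weighted_comp \<psi> \<phi> f x) powr p
    = w x powr p * (\<sigma>1 (\<phi> x) powr p * cmod (f (\<phi> x)) powr p)"
proof -
  have "0 < \<sigma>1 (\<phi> x)" "0 < \<sigma>2 x" using \<sigma>1 \<sigma>2 by (auto simp: weight_function_def)
  then show ?thesis
    by (simp add: w_def weighted_comp_def norm_mult norm_divide powr_mult powr_divide)
qed

lemma mean_pow_weighted_comp:
  "mean_pow \<sigma>2 n (weighted_comp \<psi> \<phi> f)
    = (1 / real (c n)) * (\<Sum>x\<in>S n. w x powr p * (\<sigma>1 (\<phi> x) powr p * cmod (f (\<phi> x)) powr p))"
  by (simp add: mean_pow_def weighted_comp_pow)

text \<open>The cutoff cancels \<open>\<sigma>1\<close>, so its image measures exactly the averages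
  of \<open>w x powr p\<close> over a chosen range of \<open>\<phi> x\<close>.\<close>

lemma mean_pow_weighted_comp_cutoff:
  "mean_pow \<sigma>2 n (weighted_comp \<psi> \<phi> (\<lambda>y. if P y then 1 / complex_of_real (\<sigma>1 y) else 0))
    = (1 / real (c n)) * (\<Sum>x\<in>{x\<in>S n. P (\<phi> x)}. w x powr p)"
proof -
  have "w x powr p * (\<sigma>1 (\<phi> x) powr p *
      cmod (if P (\<phi> x) then 1 / complex_of_real (\<sigma>1 (\<phi> x)) else 0) powr p)
      = (if P (\<phi> x) then w x powr p else 0)" for x
  proof -
    have "0 < \<sigma>1 (\<phi> x)" using \<sigma>1 by (simp add: weight_function_def)
    then show ?thesis by (simp add: norm_divide powr_divide)
  qed
  then show ?thesis
    by (simp add: mean_pow_weighted_comp sum.If_cases[OF finite_sphere] Int_def)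
qed

lemma linear_operator_weighted_comp:
  "linear_operator (tspace adj rt \<sigma>1 p) (tspace adj rt \<sigma>2 p) (weighted_comp \<psi> \<phi>)"
  using maps_into by (auto simp: linear_operator_def weighted_comp_def algebra_simps fun_eq_iff)

lemma low_averages_bounded:
  obtains B where "0 < B" "\<And>n. (1 / real (c n)) * (\<Sum>x\<in>{x\<in>S n. lev (\<phi> x) < m}. w x powr p) \<le> B"
proof -
  from maps_into[OF cutoff_in_tspace[OF \<sigma>1, of "\<lambda>y. lev y < m"]]
  obtain C where "0 \<le> C"
    "\<And>n. (1 / real (c n)) * (\<Sum>x\<in>{x\<in>S n. lev (\<phi> x) < m}. w x powr p) \<le> C powr p"
    unfolding tspace_iff mean_pow_weighted_comp_cutoff by auto
  \<comment> \<open>The summand 1 makes the bound positive, as it later serves as a divisor.\<close>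
  then show thesis using that[of "C powr p + 1"] by (smt (verit) powr_ge_zero)
qed

text \<open>The level is split according to whether \<open>\<phi> x\<close> lies below level
  \<open>m\<close>. Smallness of \<open>h\<close> controls the low part, where the averages are
  bounded; growth of \<open>h\<close> is paid for by the tail in the high part.\<close>

lemma mean_pow_weighted_comp_le:
  assumes low: "\<And>y. lev y < m \<Longrightarrow> \<sigma>1 y powr p * cmod (h y) powr p \<le> \<delta>"
    and high: "\<And>y. \<sigma>1 y powr p * cmod (h y) powr p \<le> K * real (c (lev y))"
  shows "mean_pow \<sigma>2 n (weighted_comp \<psi> \<phi> h)
    \<le> \<delta> * ((1 / real (c n)) * (\<Sum>x\<in>{x\<in>S n. lev (\<phi> x) < m}. w x powr p))
      + K * ((1 / real (c n)) * (\<Sum>x\<in>{x\<in>S n. lev (\<phi> x) \<ge> m}. w x powr p * real (c (lev (\<phi> x)))))"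
proof -
  let ?t = "\<lambda>x. w x powr p * (\<sigma>1 (\<phi> x) powr p * cmod (h (\<phi> x)) powr p)"
  let ?L = "{x\<in>S n. lev (\<phi> x) < m}" and ?H = "{x\<in>S n. lev (\<phi> x) \<ge> m}"
  have "S n = ?L \<union> ?H" by auto
  then have "sum ?t (S n) = sum ?t (?L \<union> ?H)" by simp
  also have "\<dots> = sum ?t ?L + sum ?t ?H"
    by (rule sum.union_disjoint) (auto simp: finite_sphere)
  finally have split: "sum ?t (S n) = sum ?t ?L + sum ?t ?H" .
  have low_sum: "sum ?t ?L \<le> (\<Sum>x\<in>?L. \<delta> * w x powr p)"
  proof (rule sum_mono)
    fix x assume "x \<in> ?L"
    then show "?t x \<le> \<delta> * w x powr p"
      using mult_left_mono[OF low[of "\<phi> x"], of "w x powr p"] by (simp add: mult.commute)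
  qed
  have high_sum: "sum ?t ?H \<le> (\<Sum>x\<in>?H. K * (w x powr p * real (c (lev (\<phi> x)))))"
  proof (rule sum_mono)
    fix x
    have "?t x \<le> w x powr p * (K * real (c (lev (\<phi> x))))"
      by (rule mult_left_mono[OF high]) simp
    then show "?t x \<le> K * (w x powr p * real (c (lev (\<phi> x))))"
      by (simp only: mult.left_commute)
  qed
  have "sum ?t (S n) \<le> \<delta> * (\<Sum>x\<in>?L. w x powr p)
      + K * (\<Sum>x\<in>?H. w x powr p * real (c (lev (\<phi> x))))"
    unfolding split sum_distrib_left by (rule add_mono[OF low_sum high_sum])
  then have "(1 / real (c n)) * sum ?t (S n) \<le> (1 / real (c n)) * (\<delta> * (\<Sum>x\<in>?L. w x powr p)
      + K * (\<Sum>x\<in>?H. w x powr p * real (c (lev (\<phi> x)))))"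
    by (rule mult_left_mono) simp
  then show ?thesis unfolding mean_pow_weighted_comp by (simp add: algebra_simps)
qed

section \<open>Sufficiency of the weighted tail condition\<close>

lemma weighted_comp_tendsto:
  assumes tail: "(\<lambda>m. SUP n. ennreal ((1 / real (c n)) *
      (\<Sum>x\<in>{x\<in>S n. lev (\<phi> x) \<ge> m}. w x powr p * real (c (lev (\<phi> x)))))) \<longlonglongrightarrow> 0"
    and K: "0 < K" "\<And>k y. \<sigma>1 y powr p * cmod (h k y) powr p \<le> K * real (c (lev y))"
    and h: "\<And>y. (\<lambda>k. h k y) \<longlonglongrightarrow> 0"
  shows "(\<lambda>k. tnorm adj rt \<sigma>2 p (weighted_comp \<psi> \<phi> (h k))) \<longlonglongrightarrow> 0"
  unfolding ennreal_LIMSEQ_0_iff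
proof (intro allI impI)
  fix e :: real assume "0 < e"
  \<comment> \<open>The tail fixes \<open>m\<close>, then \<open>B\<close> bounds the low averages
    for this \<open>m\<close>, then \<open>N\<close> makes \<open>h k\<close> small on the finitely
    many vertices below level \<open>m\<close>. Each part contributes at most half of
    \<open>e powr p\<close>.\<close>
  define \<epsilon> where "\<epsilon> = e powr p / 2"
  have \<epsilon>: "0 < \<epsilon>" using \<open>0 < e\<close> by (simp add: \<epsilon>_def)
  from tail K(1) \<epsilon> obtain m where "(SUP n. ennreal ((1 / real (c n)) *
      (\<Sum>x\<in>{x\<in>S n. lev (\<phi> x) \<ge> m}. w x powr p * real (c (lev (\<phi> x)))))) \<le> ennreal (\<epsilon> / K)"
    unfolding ennreal_LIMSEQ_0_iff by (meson divide_pos_pos order_refl)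
  then have high: "(1 / real (c n)) *
      (\<Sum>x\<in>{x\<in>S n. lev (\<phi> x) \<ge> m}. w x powr p * real (c (lev (\<phi> x)))) \<le> \<epsilon> / K" for n
    using \<epsilon> K(1) by (auto simp: SUP_le_iff ennreal_le_iff)
  obtain B where B: "0 < B"
    "\<And>n. (1 / real (c n)) * (\<Sum>x\<in>{x\<in>S n. lev (\<phi> x) < m}. w x powr p) \<le> B"
    using low_averages_bounded[of m] by blast
  have "\<forall>\<^sub>F k in sequentially. \<sigma>1 y powr p * cmod (h k y) powr p < \<epsilon> / B" for y
  proof -
    have "(\<lambda>k. cmod (h k y) powr p) \<longlonglongrightarrow> 0 powr p"
      using tendsto_norm[OF h[of y]] p_pos
      by (intro tendsto_powr2) (auto intro: tendsto_const)
    then have "(\<lambda>k. \<sigma>1 y powr p * cmod (h k y) powr p) \<longlonglongrightarrow> \<sigma>1 y powr p * 0"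
      using p_pos by (intro tendsto_mult tendsto_const) simp
    then show ?thesis using \<epsilon> B(1) by (intro order_tendstoD(2)) auto
  qed
  then have "\<forall>\<^sub>F k in sequentially. \<forall>y\<in>{y. lev y < m}.
      \<sigma>1 y powr p * cmod (h k y) powr p < \<epsilon> / B"
    by (intro eventually_ball_finite finite_levels_less) auto
  then obtain N where N:
    "\<And>k y. k \<ge> N \<Longrightarrow> lev y < m \<Longrightarrow> \<sigma>1 y powr p * cmod (h k y) powr p < \<epsilon> / B"
    by (auto simp: eventually_sequentially)
  have "tnorm adj rt \<sigma>2 p (weighted_comp \<psi> \<phi> (h k)) \<le> ennreal e" if "k \<ge> N" for k
  proof -
    have "mean_pow \<sigma>2 n (weighted_comp \<psi> \<phi> (h k)) \<le> e powr p" for n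
    proof -
      have "mean_pow \<sigma>2 n (weighted_comp \<psi> \<phi> (h k)) \<le>
        \<epsilon> / B * ((1 / real (c n)) * (\<Sum>x\<in>{x\<in>S n. lev (\<phi> x) < m}. w x powr p))
        + K * ((1 / real (c n)) * (\<Sum>x\<in>{x\<in>S n. lev (\<phi> x) \<ge> m}. w x powr p * real (c (lev (\<phi> x)))))"
        using N[OF that] K(2) by (intro mean_pow_weighted_comp_le) (auto intro: less_imp_le)
      also have "\<dots> \<le> \<epsilon> / B * B + K * (\<epsilon> / K)"
        using \<epsilon> B K(1) high by (intro add_mono mult_left_mono) auto
      also have "\<dots> = e powr p" using B K(1) by (simp add: \<epsilon>_def)
      finally show ?thesis .
    qed
    then show ?thesis using \<open>0 < e\<close> by (simp add: tnorm_le_iff)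
  qed
  then show "\<exists>N. \<forall>k\<ge>N. tnorm adj rt \<sigma>2 p (weighted_comp \<psi> \<phi> (h k)) \<le> ennreal e" by blast
qed

lemma compact_operator_weighted_comp:
  assumes tail: "(\<lambda>m. SUP n. ennreal ((1 / real (c n)) *
      (\<Sum>x\<in>{x\<in>S n. lev (\<phi> x) \<ge> m}. w x powr p * real (c (lev (\<phi> x)))))) \<longlonglongrightarrow> 0"
  shows "compact_operator (tspace adj rt \<sigma>1 p) (tnorm adj rt \<sigma>1 p)
    (tspace adj rt \<sigma>2 p) (tnorm adj rt \<sigma>2 p) (weighted_comp \<psi> \<phi>)"
  unfolding compact_operator_def
proof (intro conjI linear_operator_weighted_comp allI impI)
  fix f :: "nat \<Rightarrow> 'v \<Rightarrow> complex"
  assume "(\<forall>k. f k \<in> tspace adj rt \<sigma>1 p) \<and> (\<exists>C. \<forall>k. tnorm adj rt \<sigma>1 p (f k) \<le> ennreal C)"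
  then obtain C' where C': "\<And>k. tnorm adj rt \<sigma>1 p (f k) \<le> ennreal C'" by blast
  \<comment> \<open>\<open>C'\<close> may be zero or negative, while a positive constant is needed
    for \<open>tnorm_le_iff\<close> and for \<open>K\<close>.\<close>
  define C where "C = max C' 1"
  have C: "0 < C" and "\<And>k. tnorm adj rt \<sigma>1 p (f k) \<le> ennreal C"
    using C' order_trans[OF C' ennreal_leI[of C' C]] by (auto simp: C_def)
  then have f_mean: "mean_pow \<sigma>1 n (f k) \<le> C powr p" for n k
    by (simp add: tnorm_le_iff)
  \<comment> \<open>The p-th root of the one-summand bound; it does not depend on \<open>k\<close>,
    which allows the extraction of a subsequence.\<close>
  define R where "R y = real (c (lev y)) powr (1 / p) * C" for y
  have R_pow: "R y powr p = C powr p * real (c (lev y))" for y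
    using p_pos by (simp add: R_def powr_mult powr_powr)
  have bound: "\<sigma>1 y * cmod (g y) \<le> R y"
    if g: "\<And>n. mean_pow \<sigma>1 n g \<le> C powr p" for g y
  proof -
    have pos: "0 < \<sigma>1 y" using \<sigma>1 by (simp add: weight_function_def)
    have "(\<sigma>1 y * cmod (g y)) powr p = \<sigma>1 y powr p * cmod (g y) powr p"
      using pos by (simp add: powr_mult)
    also have "\<dots> \<le> real (c (lev y)) * mean_pow \<sigma>1 (lev y) g" by (rule weight_pow_le_mean_pow)
    also have "\<dots> \<le> R y powr p"
      using mult_left_mono[OF g[of "lev y"], of "real (c (lev y))"] by (simp add: R_pow mult.commute)
    finally show ?thesis
      using p_pos C powr_less_mono2[of p "R y" "\<sigma>1 y * cmod (g y)"]
      by (force simp: R_def not_le[symmetric])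
  qed
  have "cmod (f k y) \<le> R y / \<sigma>1 y" for k y
  proof -
    have pos: "0 < \<sigma>1 y" using \<sigma>1 by (simp add: weight_function_def)
    then show ?thesis using bound[OF f_mean, where y = y]
      by (simp add: field_simps)
  qed
  then obtain s g where s: "strict_mono (s :: nat \<Rightarrow> nat)" and g: "\<And>x. (\<lambda>k. f (s k) x) \<longlonglongrightarrow> g x"
    using pointwise_convergent_subsequence[OF countable_vertices, of f "\<lambda>y. R y / \<sigma>1 y"] by blast
  \<comment> \<open>Averages over a finite level pass to the pointwise limit. Hence \<open>g\<close>
    lies in the source space and its image is the required limit.\<close>
  have g_mean: "mean_pow \<sigma>1 n g \<le> C powr p" for n
  proof (rule LIMSEQ_le_const2)
    show "(\<lambda>k. mean_pow \<sigma>1 n (f (s k))) \<longlonglongrightarrow> mean_pow \<sigma>1 n g"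
      unfolding mean_pow_def using p_pos g
      by (intro tendsto_intros tendsto_powr2 tendsto_norm) (auto intro: tendsto_const)
  qed (use f_mean in auto)
  have g_space: "g \<in> tspace adj rt \<sigma>1 p" using g_mean C by (auto simp: tspace_iff intro!: exI[of _ C])
  define h where "h k y = f (s k) y - g y" for k y
  \<comment> \<open>Applying the triangle inequality to the values before raising to the power
    \<open>p\<close> also covers p < 1; it costs the factor \<open>2 powr p\<close>.\<close>
  have h_bound: "\<sigma>1 y powr p * cmod (h k y) powr p \<le> (2 powr p * C powr p) * real (c (lev y))" for k y
  proof -
    have pos: "0 < \<sigma>1 y" using \<sigma>1 by (simp add: weight_function_def)
    have "\<sigma>1 y * cmod (h k y) \<le> \<sigma>1 y * (cmod (f (s k) y) + cmod (g y))"
      using pos norm_triangle_ineq4[of "f (s k) y" "g y"] by (simp add: h_def)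
    also have "\<dots> \<le> 2 * R y"
      using bound[OF f_mean, of y "s k"] bound[OF g_mean, of y] by (simp add: algebra_simps)
    finally have "(\<sigma>1 y * cmod (h k y)) powr p \<le> (2 * R y) powr p"
      using pos p_pos by (intro powr_mono2) auto
    then show ?thesis using pos C by (simp add: powr_mult R_pow)
  qed
  have "(\<lambda>k. tnorm adj rt \<sigma>2 p (weighted_comp \<psi> \<phi> (h k))) \<longlonglongrightarrow> 0"
    using C h_bound g by (intro weighted_comp_tendsto[OF tail, where K = "2 powr p * C powr p"])
      (auto simp: h_def LIM_zero_iff)
  moreover have "weighted_comp \<psi> \<phi> (h k)
      = (\<lambda>x. weighted_comp \<psi> \<phi> (f (s k)) x - weighted_comp \<psi> \<phi> g x)" for k
    by (simp add: weighted_comp_def h_def algebra_simps)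
  ultimately show "\<exists>s. strict_mono s \<and> (\<exists>g\<in>tspace adj rt \<sigma>2 p.
      (\<lambda>k. tnorm adj rt \<sigma>2 p (\<lambda>x. weighted_comp \<psi> \<phi> (f (s k)) x - g x)) \<longlonglongrightarrow> 0)"
    using s maps_into[OF g_space] by auto
qed

section \<open>Necessity of the unweighted tail condition\<close>

lemma tail_averages_tendsto:
  assumes "compact_operator (tspace adj rt \<sigma>1 p) (tnorm adj rt \<sigma>1 p)
    (tspace adj rt \<sigma>2 p) (tnorm adj rt \<sigma>2 p) (weighted_comp \<psi> \<phi>)"
  shows "(\<lambda>m. SUP n. ennreal ((1 / real (c n)) *
      (\<Sum>x\<in>{x\<in>S n. lev (\<phi> x) \<ge> m}. w x powr p))) \<longlonglongrightarrow> 0"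
proof -
  define G where "G m = (\<lambda>y. if lev y \<ge> m then 1 / complex_of_real (\<sigma>1 y) else 0)" for m
  have G: "G m \<in> tspace adj rt \<sigma>1 p" "tnorm adj rt \<sigma>1 p (G m) \<le> ennreal 1" for m
    unfolding G_def by (rule cutoff_in_tspace[OF \<sigma>1] tnorm_cutoff[OF \<sigma>1])+
  have W_G: "mean_pow \<sigma>2 n (weighted_comp \<psi> \<phi> (G m))
      = (1 / real (c n)) * (\<Sum>x\<in>{x\<in>S n. lev (\<phi> x) \<ge> m}. w x powr p)" for n m
    unfolding G_def by (rule mean_pow_weighted_comp_cutoff)
  obtain s g where s: "strict_mono (s :: nat \<Rightarrow> nat)" and
    lim: "(\<lambda>k. tnorm adj rt \<sigma>2 p (\<lambda>x. weighted_comp \<psi> \<phi> (G (s k)) x - g x)) \<longlonglongrightarrow> 0"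
    using assms G unfolding compact_operator_def by blast
  have "g x = 0" for x
  proof (rule ccontr)
    assume "g x \<noteq> 0"
    \<comment> \<open>The contribution of the single vertex \<open>x\<close> to the average of
      \<open>g\<close> on its level. A norm of at most \<open>e\<close>, with
      \<open>e powr p = a / 2\<close>, is incompatible with it once the image of the cutoff vanishes
      at \<open>x\<close>.\<close>
    define a where "a = \<sigma>2 x powr p * cmod (g x) powr p / real (c (lev x))"
    have "0 < \<sigma>2 x" using \<sigma>2 by (simp add: weight_function_def)
    then have a: "0 < a" using \<open>g x \<noteq> 0\<close> level_count_pos[of x] by (simp add: a_def)
    define e where "e = (a / 2) powr (1 / p)"
    have e: "0 < e" "e powr p = a / 2" using a p_pos by (auto simp: e_def powr_powr)
    from lim e(1) obtain N where
      N: "\<And>k. k \<ge> N \<Longrightarrow> tnorm adj rt \<sigma>2 p (\<lambda>x. weighted_comp \<psi> \<phi> (G (s k)) x - g x) \<le> ennreal e"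
      unfolding ennreal_LIMSEQ_0_iff by blast
    \<comment> \<open>A strictly increasing \<open>s\<close> satisfies \<open>k \<le> s k\<close>,
      so the cutoff level exceeds that of \<open>\<phi> x\<close>.\<close>
    define k where "k = max N (Suc (lev (\<phi> x)))"
    have "lev (\<phi> x) < s k" using seq_suble[OF s, of k] by (auto simp: k_def)
    then have Gk: "weighted_comp \<psi> \<phi> (G (s k)) x = 0" by (simp add: weighted_comp_def G_def)
    have "mean_pow \<sigma>2 (lev x) (\<lambda>x. weighted_comp \<psi> \<phi> (G (s k)) x - g x) \<le> a / 2"
      using N[of k] e by (auto simp: tnorm_le_iff k_def)
    then have "real (c (lev x)) * mean_pow \<sigma>2 (lev x) (\<lambda>x. weighted_comp \<psi> \<phi> (G (s k)) x - g x)
        \<le> real (c (lev x)) * (a / 2)" by (rule mult_left_mono) simp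
    with weight_pow_le_mean_pow[of \<sigma>2 x "\<lambda>x. weighted_comp \<psi> \<phi> (G (s k)) x - g x"]
    have "\<sigma>2 x powr p * cmod (g x) powr p \<le> real (c (lev x)) * (a / 2)"
      by (simp add: Gk)
    also have "\<dots> = \<sigma>2 x powr p * cmod (g x) powr p / 2"
      using level_count_pos[of x] by (simp add: a_def)
    finally show False using \<open>0 < \<sigma>2 x\<close> \<open>g x \<noteq> 0\<close> by simp
  qed
  with lim have lim0: "(\<lambda>k. tnorm adj rt \<sigma>2 p (weighted_comp \<psi> \<phi> (G (s k)))) \<longlonglongrightarrow> 0" by simp
  show ?thesis unfolding ennreal_LIMSEQ_0_iff
  proof (intro allI impI)
    fix \<epsilon> :: real assume "0 < \<epsilon>"
    define e where "e = \<epsilon> powr (1 / p)"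
    have e: "0 < e" "e powr p = \<epsilon>" using \<open>0 < \<epsilon>\<close> p_pos by (auto simp: e_def powr_powr)
    \<comment> \<open>One index suffices: raising the cutoff only drops nonnegative terms, so the
      bound at \<open>s N\<close> covers every larger \<open>m\<close>, not only values of
      \<open>s\<close>.\<close>
    from lim0 e(1) obtain N where
      "tnorm adj rt \<sigma>2 p (weighted_comp \<psi> \<phi> (G (s N))) \<le> ennreal e"
      unfolding ennreal_LIMSEQ_0_iff by blast
    then have N: "mean_pow \<sigma>2 n (weighted_comp \<psi> \<phi> (G (s N))) \<le> \<epsilon>" for n
      using e by (simp add: tnorm_le_iff)
    have "(1 / real (c n)) * (\<Sum>x\<in>{x\<in>S n. lev (\<phi> x) \<ge> m}. w x powr p) \<le> \<epsilon>" if "m \<ge> s N" for m n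
    proof -
      have "(\<Sum>x\<in>{x\<in>S n. lev (\<phi> x) \<ge> m}. w x powr p) \<le> (\<Sum>x\<in>{x\<in>S n. lev (\<phi> x) \<ge> s N}. w x powr p)"
        using that by (intro sum_mono2) (auto simp: finite_sphere)
      then have "(1 / real (c n)) * (\<Sum>x\<in>{x\<in>S n. lev (\<phi> x) \<ge> m}. w x powr p)
          \<le> (1 / real (c n)) * (\<Sum>x\<in>{x\<in>S n. lev (\<phi> x) \<ge> s N}. w x powr p)"
        by (rule mult_left_mono) simp
      then show ?thesis using N[of n] unfolding W_G by linarith
    qed
    then show "\<exists>N. \<forall>m\<ge>N. (SUP n. ennreal ((1 / real (c n)) *
        (\<Sum>x\<in>{x\<in>S n. lev (\<phi> x) \<ge> m}. w x powr p))) \<le> ennreal \<epsilon>"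
      using \<open>0 < \<epsilon>\<close> by (intro exI[of _ "s N"]) (auto intro!: SUP_least ennreal_leI)
  qed
qed

end

theorem theorem12:
  fixes adj :: "'v \<Rightarrow> 'v \<Rightarrow> bool" and rt :: 'v and p :: real
    and \<sigma>1 \<sigma>2 :: "'v \<Rightarrow> real" and \<phi> :: "'v \<Rightarrow> 'v" and \<psi> :: "'v \<Rightarrow> complex"
  assumes "is_tree adj"
    and "infinite (UNIV :: 'v set)"
    and "\<And>n. finite (sphere_at adj rt n)"
    and "\<not> bdd_above (range (level_count adj rt))"
    and "0 < p"
    and "weight_function \<sigma>1" and "weight_function \<sigma>2"
    and "\<And>f. f \<in> tspace adj rt \<sigma>1 p \<Longrightarrow> weighted_comp \<psi> \<phi> f \<in> tspace adj rt \<sigma>2 p"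
  shows
    "((\<lambda>m::nat. SUP n. ennreal ((1 / real (level_count adj rt n)) *
         (\<Sum>x\<in>{x \<in> sphere_at adj rt n. graph_dist adj rt (\<phi> x) \<ge> m}.
            cmod (complex_of_real (\<sigma>2 x) * \<psi> x / complex_of_real (\<sigma>1 (\<phi> x))) powr p
              * real (level_count adj rt (graph_dist adj rt (\<phi> x)))))) \<longlonglongrightarrow> 0
      \<longrightarrow> compact_operator (tspace adj rt \<sigma>1 p) (tnorm adj rt \<sigma>1 p)
            (tspace adj rt \<sigma>2 p) (tnorm adj rt \<sigma>2 p) (weighted_comp \<psi> \<phi>))
     \<and>
     (compact_operator (tspace adj rt \<sigma>1 p) (tnorm adj rt \<sigma>1 p)
            (tspace adj rt \<sigma>2 p) (tnorm adj rt \<sigma>2 p) (weighted_comp \<psi> \<phi>)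
      \<longrightarrow> (\<lambda>m::nat. SUP n. ennreal ((1 / real (level_count adj rt n)) *
         (\<Sum>x\<in>{x \<in> sphere_at adj rt n. graph_dist adj rt (\<phi> x) \<ge> m}.
            cmod (complex_of_real (\<sigma>2 x) * \<psi> x / complex_of_real (\<sigma>1 (\<phi> x))) powr p))) \<longlonglongrightarrow> 0)"
proof -
  interpret weighted_comp_map adj rt p \<sigma>1 \<sigma>2 \<phi> \<psi>
    by unfold_locales (fact assms)+
  show ?thesis
    using compact_operator_weighted_comp tail_averages_tendsto unfolding w_def by blast
qed

end
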